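(* Let $a>b>0$ be real numbers and let $\nu\ge0$ be real with $\nu\ne 0,\frac12,1,\frac32,2,\ldots$. Then $$\sum_{n=1}^\infty \frac{e^{-an}}{(\frac12 bn)^\nu}\,K_\nu(bn)=\frac{\pi}{2\sin\pi\nu}\left\{\sum_{k=0}^\infty\frac{(\frac12 b)^{2k-2\nu}}{k!\,\Gamma(1-\nu+k)}\,\mathrm{Li}_{-2k+2\nu}(e^{-a})-\sum_{k=0}^\infty\frac{(\frac12 b)^{2k}}{k!\,\Gamma(1+\nu+k)}\,\mathrm{Li}_{-2k}(e^{-a})\right\}.$$
   Context: $K_\nu$ is the modified Bessel function of the second kind of order $\nu$, and $\mathrm{Li}_s(z)=\sum_{n=1}^\infty n^{-s}z^n$ (for $|z|<1$) is the polylogarithm function. *)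

theory Defs
  imports "HOL-Analysis.Analysis"
begin

text \<open>
  Modified Bessel functions of real order, for positive real argument. Using \<open>rGamma\<close>
  (the entire function $1/\Gamma$), terms at poles of $\Gamma$ vanish, as they should.
\<close>

definition bessel_I :: "real \<Rightarrow> real \<Rightarrow> real" where
  "bessel_I \<nu> x = (\<Sum>k. (x / 2) powr (2 * real k + \<nu>) * rGamma (\<nu> + real k + 1) / fact k)"

text \<open>
  At integer order the defining quotient is $0/0$, and \<open>K\<close> is its limit in the order;
  the filter \<open>at \<nu>\<close> omits \<open>\<nu>\<close> itself.
\<close>

definition bessel_K :: "real \<Rightarrow> real \<Rightarrow> real" where
  "bessel_K \<nu> x =
    (if \<nu> \<in> \<int>
     then Lim (at \<nu>) (\<lambda>\<mu>. pi / 2 * (bessel_I (- \<mu>) x - bessel_I \<mu> x) / sin (\<mu> * pi))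
     else pi / 2 * (bessel_I (- \<nu>) x - bessel_I \<nu> x) / sin (\<nu> * pi))"

text \<open>Meaningful for \<open>\<bar>z\<bar> < 1\<close>; the summation index is shifted so that it starts at 1.\<close>

definition polylog :: "real \<Rightarrow> real \<Rightarrow> real" where
  "polylog s z = (\<Sum>n. real (Suc n) powr (- s) * z ^ Suc n)"

end

(*
  Expanding both Bessel functions of the first kind in K_nu and exchanging the order of
  summation gives the identity. The exchange is legitimate because, for b < c < a, ratio
  comparison with (2k)! bounds the double series by a multiple of
  exp (-a n) (c n)^(2k) / (2k)!, whose sum over k is exp (-a n) cosh (c n).
*)

theory Submission
  imports Defs
begin

section \<open>Interchange of summation for dominated double series\<close>

lemma has_sum_imp_iterated_sums:
  fixes f :: "nat \<Rightarrow> nat \<Rightarrow> real"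
  assumes "((\<lambda>(n, k). f n k) has_sum S) (UNIV \<times> UNIV)"
  shows "summable (f n)" and "(\<lambda>n. \<Sum>k. f n k) sums S"
proof -
  have "(\<lambda>(n, k). f n k) summable_on Sigma UNIV (\<lambda>_. UNIV)"
    using assms has_sum_imp_summable by blast
  then have f_summable: "f n summable_on UNIV" for n
    using summable_on_SigmaD1[of f UNIV "\<lambda>_. UNIV" n] by simp
  show "summable (f n)"
    using f_summable by (rule summable_on_imp_summable)
  have f_has_sum: "(f n has_sum (\<Sum>k. f n k)) UNIV" for n
    using f_summable[of n] has_sum_imp_sums has_sum_infsum sums_unique by metis
  have "((\<lambda>n. \<Sum>k. f n k) has_sum S) UNIV"
    by (rule has_sum_SigmaD[OF assms]) (simp add: f_has_sum)
  then show "(\<lambda>n. \<Sum>k. f n k) sums S"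
    by (rule has_sum_imp_sums)
qed

text \<open>Since \<open>h\<close> is nonnegative, its convergent iterated sum already gives
  unconditional summability over all pairs, and comparison passes this on to
  \<open>f\<close>.\<close>

lemma dominated_double_series:
  fixes f h :: "nat \<Rightarrow> nat \<Rightarrow> real"
  assumes bound: "\<And>n k. \<bar>f n k\<bar> \<le> h n k"
    and h_sums: "\<And>n. h n sums H n" and H_summable: "summable H"
  shows "summable (\<lambda>n. f n k)"
    and "summable (\<lambda>k. \<Sum>n. f n k)"
    and "summable (f n)"
    and "(\<lambda>n. \<Sum>k. f n k) sums (\<Sum>k. \<Sum>n. f n k)"
proof -
  have h_nonneg: "0 \<le> h n k" for n k
    using bound[of n k] by linarith
  have H_nonneg: "0 \<le> H n" for n
    using sums_le[OF _ sums_zero h_sums, of n] h_nonneg by simp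
  have "(\<lambda>(n, k). h n k) summable_on (UNIV \<times> UNIV)"
  proof (rule summable_on_SigmaI)
    show "((\<lambda>k. (\<lambda>(n, k). h n k) (n, k)) has_sum H n) UNIV" for n
      using h_sums h_nonneg by (auto intro!: sums_nonneg_imp_has_sum)
    show "H summable_on UNIV"
      using H_summable H_nonneg by (intro summable_nonneg_imp_summable_on)
  qed (auto simp: h_nonneg)
  then have "(\<lambda>x. norm ((\<lambda>(n, k). f n k) x)) summable_on (UNIV \<times> UNIV)"
    by (rule summable_on_comparison_test) (auto simp: bound)
  then have "(\<lambda>(n, k). f n k) summable_on (UNIV \<times> UNIV)"
    by (rule abs_summable_summable)
  then obtain S where S: "((\<lambda>(n, k). f n k) has_sum S) (UNIV \<times> UNIV)"
    by (auto simp: summable_on_def)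
  \<comment> \<open>An unconditional sum ignores the order of the coordinates, so both iterated sums
    equal the same \<open>S\<close>.\<close>
  then have S': "((\<lambda>(k, n). f n k) has_sum S) (UNIV \<times> UNIV)"
    by (subst (asm) has_sum_swap) simp
  show "summable (\<lambda>n. f n k)" "summable (f n)"
    using has_sum_imp_iterated_sums(1)[OF S] has_sum_imp_iterated_sums(1)[OF S'] by auto
  show "summable (\<lambda>k. \<Sum>n. f n k)"
    using has_sum_imp_iterated_sums(2)[OF S'] by (rule sums_summable)
  show "(\<lambda>n. \<Sum>k. f n k) sums (\<Sum>k. \<Sum>n. f n k)"
    using has_sum_imp_iterated_sums(2)[OF S] has_sum_imp_iterated_sums(2)[OF S'] sums_unique
    by metis
qed

section \<open>The majorant: even exponential series and coefficient growth\<close>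

lemma cosh_series: "(\<lambda>k. x ^ (2 * k) / fact (2 * k)) sums cosh (x :: real)"
proof -
  have "strict_mono (\<lambda>k::nat. 2 * k)"
    by (auto intro: strict_monoI)
  \<comment> \<open>Only zero terms, those of odd index, are dropped from the power series of
    cosh.\<close>
  then have "(\<lambda>k. (\<lambda>n. if even n then x ^ n /\<^sub>R fact n else 0) (2 * k)) sums cosh x"
    by (subst sums_mono_reindex) (auto simp: cosh_converges elim: evenE)
  then show ?thesis
    by (simp add: divide_inverse mult.commute)
qed

text \<open>The quotient (2k)! / (4^k k!) is \<Gamma>(k + 1/2) / sqrt \<pi>, so without the last
  factor the expression behaves at most like a power of k, which \<open>r ^ (2 * k)\<close> absorbs.
  The ratio test replaces these asymptotics: consecutive quotients tend to r^2 < 1, so the terms are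
  even summable.\<close>

lemma bessel_coeff_bounded:
  fixes \<mu> r :: real
  assumes "0 < r" "r < 1"
  obtains C where "0 \<le> C"
    and "\<And>k. \<bar>rGamma (\<mu> + real k + 1)\<bar> * fact (2 * k) / (4 ^ k * fact k) * r ^ (2 * k) \<le> C"
proof -
  define g where
    "g k = \<bar>rGamma (\<mu> + real k + 1)\<bar> * fact (2 * k) / (4 ^ k * fact k) * r ^ (2 * k)" for k
  have g_nonneg: "0 \<le> g k" for k
    using assms by (auto simp: g_def)
  have r2: "r\<^sup>2 < 1" "0 < r\<^sup>2"
    using assms by (auto simp: power_less_one_iff)
  \<comment> \<open>The recurrence is stated as a product because \<open>\<mu> + real k + 1\<close>
    can be zero when \<open>\<mu>\<close> is a negative integer.\<close>
  have ratio: "\<bar>\<mu> + real k + 1\<bar> * g (Suc k) = (real k + 1 / 2) * r\<^sup>2 * g k" for k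
  proof -
    have "rGamma (\<mu> + real k + 1) = (\<mu> + real k + 1) * rGamma (\<mu> + real (Suc k) + 1)"
      using rGamma_plus1[of "\<mu> + real k + 1"] by (simp add: add_ac)
    then have "\<bar>rGamma (\<mu> + real k + 1)\<bar>
        = \<bar>\<mu> + real k + 1\<bar> * \<bar>rGamma (\<mu> + real (Suc k) + 1)\<bar>"
      by (simp add: abs_mult)
    moreover have "fact (2 * Suc k) / (4 ^ Suc k * fact (Suc k) :: real)
        = (real k + 1 / 2) * (fact (2 * k) / (4 ^ k * fact k))"
    proof -
      have "fact (2 * Suc k) = (2 * real k + 2) * ((2 * real k + 1) * fact (2 * k))"
        by (simp add: algebra_simps)
      moreover have "fact (Suc k) = (real k + 1) * fact k"
        by (simp add: algebra_simps)
      moreover have "real k + 1 \<noteq> 0"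
        by linarith
      ultimately show ?thesis
        by (simp add: divide_simps) (simp add: algebra_simps)
    qed
    moreover have "r ^ (2 * Suc k) = r\<^sup>2 * r ^ (2 * k)"
      by (simp add: power2_eq_square)
    ultimately show ?thesis
      unfolding g_def times_divide_eq_right[symmetric] by (simp only: mult_ac)
  qed
  \<comment> \<open>The midpoint of r^2 and 1, strictly above the limiting ratio.\<close>
  define c where "c = (1 + r\<^sup>2) / 2"
  have c: "c < 1" "r\<^sup>2 < c" "0 < c"
    using r2 by (auto simp: c_def intro: add_pos_pos)
  \<comment> \<open>The first bound makes \<open>\<mu> + real k + 1\<close> positive, so that it can
    be cancelled; the second makes k (c - r^2) outweigh a possibly negative
    \<open>c * \<mu>\<close>.\<close>
  define K where "K = nat \<lceil>max (\<bar>\<mu>\<bar> + 1) (c * (\<bar>\<mu>\<bar> + 1) / (c - r\<^sup>2))\<rceil> + 1"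
  have "norm (g (Suc k)) \<le> c * norm (g k)" if "k \<ge> K" for k
  proof -
    have k: "real k \<ge> \<bar>\<mu>\<bar> + 1" "real k \<ge> c * (\<bar>\<mu>\<bar> + 1) / (c - r\<^sup>2)"
      using that unfolding K_def by linarith+
    from k(2) have "c * (\<bar>\<mu>\<bar> + 1) \<le> real k * (c - r\<^sup>2)"
      using c by (simp add: divide_simps)
    moreover have "c * \<mu> \<ge> - (c * \<bar>\<mu>\<bar>)"
      using c mult_left_mono[of "- \<bar>\<mu>\<bar>" \<mu> c] by simp
    ultimately have "(real k + 1 / 2) * r\<^sup>2 \<le> c * (\<mu> + real k + 1)"
      using c by (simp add: algebra_simps)
    then have "(real k + 1 / 2) * r\<^sup>2 * g k \<le> c * (\<mu> + real k + 1) * g k"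
      using g_nonneg by (rule mult_right_mono)
    then have "(\<mu> + real k + 1) * g (Suc k) \<le> (\<mu> + real k + 1) * (c * g k)"
      using ratio[of k] k by (simp add: algebra_simps)
    then have "g (Suc k) \<le> c * g k"
      by (rule mult_left_le_imp_le) (use k in linarith)
    then show ?thesis
      using g_nonneg by simp
  qed
  then have "summable g"
    using c(1) summable_ratio_test by blast
  then have "g k \<le> (\<Sum>k. g k)" for k
    using sum_le_suminf[of g "{k}"] g_nonneg by simp
  then show ?thesis
    using that[of "\<Sum>k. g k"] g_nonneg[of 0] unfolding g_def by (meson order_trans)
qed

section \<open>The double series attached to one Bessel function of the first kind\<close>

context
  fixes a b d \<mu> :: real
  assumes ab: "b < a" "0 < b" and d: "d \<le> 0"
begin

text \<open>Keeping \<open>d\<close> apart from \<open>\<mu>\<close> lets one family serve both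
  series of the theorem: the pairs (\<open>d\<close>, \<open>\<mu>\<close>) are
  (\<open>- 2 * \<nu>\<close>, \<open>- \<nu>\<close>) and (\<open>0\<close>, \<open>\<nu>\<close>),
  both with \<open>d - \<mu> = - \<nu>\<close>. Row \<open>n\<close> stands for the summation index
  n + 1.\<close>

definition bessel_term :: "nat \<Rightarrow> nat \<Rightarrow> real" where
  "bessel_term n k = exp (- a * real (Suc n))
     * ((b * real (Suc n) / 2) powr (2 * real k + d) * rGamma (\<mu> + real k + 1) / fact k)"

text \<open>Enlarging \<open>b\<close> to some \<open>c\<close> below \<open>a\<close> frees a
  factor (b/c)^(2k), which pays for the coefficients by \<open>bessel_coeff_bounded\<close>, while
  exp (-a n) still beats cosh (c n).\<close>

lemma bessel_term_dominated:
  obtains c C where "0 < c" "c < a"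
    and "\<And>n k. \<bar>bessel_term n k\<bar>
      \<le> C * exp (- a * real (Suc n)) * ((c * real (Suc n)) ^ (2 * k) / fact (2 * k))"
proof -
  define c where "c = (a + b) / 2"
  have c: "0 < c" "c < a" "b < c"
    using ab by (auto simp: c_def)
  obtain C where C: "0 \<le> C"
    "\<And>k. \<bar>rGamma (\<mu> + real k + 1)\<bar> * fact (2 * k) / (4 ^ k * fact k) * (b / c) ^ (2 * k) \<le> C"
    using bessel_coeff_bounded[of "b / c" \<mu>] c ab by auto
  have "\<bar>bessel_term n k\<bar> \<le> (b / 2) powr d * C * exp (- a * real (Suc n))
          * ((c * real (Suc n)) ^ (2 * k) / fact (2 * k))" for n k
  proof -
    define N where "N = real (Suc n)"
    define G where "G = \<bar>rGamma (\<mu> + real k + 1)\<bar>"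
    have N: "1 \<le> N"
      by (simp add: N_def)
    have "(b * N / 2) powr (2 * real k + d) = (b * N / 2) ^ (2 * k) * (b * N / 2) powr d"
      using ab N powr_realpow[of "b * N / 2" "2 * k"] by (simp add: powr_add)
    also have "(b * N / 2) powr d = (b / 2) powr d * N powr d"
      using ab N powr_mult[of "b / 2" N d] by simp
    also have "(b * N / 2) ^ (2 * k) = (b / c) ^ (2 * k) * (c * N) ^ (2 * k) / 4 ^ k"
      using c by (simp add: power_mult_distrib power_divide power_mult)
    finally have eq: "(b * N / 2) powr (2 * real k + d)
      = (b / c) ^ (2 * k) * (c * N) ^ (2 * k) / 4 ^ k * ((b / 2) powr d * N powr d)" .
    have "\<bar>bessel_term n k\<bar> = exp (- a * N) * ((b * N / 2) powr (2 * real k + d) * G / fact k)"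
      by (simp add: bessel_term_def N_def G_def abs_mult)
    also have "\<dots> = (G * fact (2 * k) / (4 ^ k * fact k) * (b / c) ^ (2 * k)) * N powr d
        * ((b / 2) powr d * exp (- a * N) * ((c * N) ^ (2 * k) / fact (2 * k)))"
      unfolding eq by (simp add: field_simps)
    \<comment> \<open>Here the sign of \<open>d\<close> enters: \<open>N powr d\<close> is at most 1
      because \<open>N\<close> is at least 1.\<close>
    also have "\<dots> \<le> C * 1 * ((b / 2) powr d * exp (- a * N) * ((c * N) ^ (2 * k) / fact (2 * k)))"
    proof (intro mult_right_mono mult_mono)
      show "N powr d \<le> 1"
        using powr_mono[OF d N] N by simp
      show "G * fact (2 * k) / (4 ^ k * fact k) * (b / c) ^ (2 * k) \<le> C"
        using C(2) by (simp add: G_def)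
    qed (use C c N in auto)
    finally show ?thesis
      by (simp add: N_def mult_ac)
  qed
  then show ?thesis
    using that c by blast
qed

text \<open>The row sums of the majorant are multiples of exp (-a N) cosh (c N), hence combinations
  of two geometric sequences with ratios exp (c - a) and exp (-c - a), both below 1.\<close>

lemma bessel_term_double_series:
  shows "summable (\<lambda>n. bessel_term n k)"
    and "summable (\<lambda>k. \<Sum>n. bessel_term n k)"
    and "summable (bessel_term n)"
    and "(\<lambda>n. \<Sum>k. bessel_term n k) sums (\<Sum>k. \<Sum>n. bessel_term n k)"
proof -
  obtain C c where c: "0 < c" "c < a" and bound: "\<And>n k. \<bar>bessel_term n k\<bar>
      \<le> C * exp (- a * real (Suc n)) * ((c * real (Suc n)) ^ (2 * k) / fact (2 * k))"
    by (rule bessel_term_dominated) (rule that)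
  have h_sums: "(\<lambda>k. C * exp (- a * real (Suc n)) * ((c * real (Suc n)) ^ (2 * k) / fact (2 * k)))
      sums (C * exp (- a * real (Suc n)) * cosh (c * real (Suc n)))" for n
    by (intro sums_mult cosh_series)
  have "C * exp (- a * real (Suc n)) * cosh (c * real (Suc n))
      = C / 2 * (exp (c - a) ^ Suc n + exp (- c - a) ^ Suc n)" for n
  proof -
    have "exp (c - a) ^ Suc n = exp (- a * real (Suc n)) * exp (c * real (Suc n))"
      "exp (- c - a) ^ Suc n = exp (- a * real (Suc n)) * exp (- (c * real (Suc n)))"
      unfolding exp_of_nat_mult[symmetric] exp_add[symmetric] by (simp_all add: algebra_simps)
    then show ?thesis
      by (simp add: cosh_field_def field_simps)
  qed
  moreover have "summable (\<lambda>n. C / 2 * (exp (c - a) ^ Suc n + exp (- c - a) ^ Suc n))"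
    using c by (intro summable_mult summable_add) (simp_all add: summable_Suc_iff summable_geometric)
  ultimately have H_summable:
      "summable (\<lambda>n. C * exp (- a * real (Suc n)) * cosh (c * real (Suc n)))"
    by (simp only:)
  show "summable (\<lambda>n. bessel_term n k)"
    and "summable (\<lambda>k. \<Sum>n. bessel_term n k)"
    and "summable (bessel_term n)"
    and "(\<lambda>n. \<Sum>k. bessel_term n k) sums (\<Sum>k. \<Sum>n. bessel_term n k)"
    using dominated_double_series[OF bound h_sums H_summable] by auto
qed

text \<open>For fixed \<open>k\<close> the power of b N / 2 splits into a constant and N^(2k+d), and
  exp (-a N) is the N-th power of exp (-a), which leaves a polylogarithm series.\<close>

lemma suminf_bessel_term_polylog:
  "(\<Sum>n. bessel_term n k) = (b / 2) powr (2 * real k + d) / (fact k * Gamma (1 + \<mu> + real k))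
     * polylog (- 2 * real k - d) (exp (- a))"
proof -
  define A where "A = (b / 2) powr (2 * real k + d) / (fact k * Gamma (1 + \<mu> + real k))"
  define p where "p n = real (Suc n) powr (2 * real k + d) * exp (- a) ^ Suc n" for n
  have *: "bessel_term n k = A * p n" for n
  proof -
    have "(b * real (Suc n) / 2) powr (2 * real k + d)
        = (b / 2) powr (2 * real k + d) * real (Suc n) powr (2 * real k + d)"
      using ab powr_mult[of "b / 2" "real (Suc n)"] by simp
    moreover have "exp (- a * real (Suc n)) = exp (- a) ^ Suc n"
      unfolding exp_of_nat_mult[symmetric] by (simp add: mult_ac)
    \<comment> \<open>This also holds at poles, where \<open>Gamma\<close> and \<open>rGamma\<close>
      both have the value 0 and so does division by 0.\<close>
    ultimately show ?thesis
      unfolding bessel_term_def A_def p_def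
      by (simp only: rGamma_inverse_Gamma divide_inverse inverse_mult_distrib)
        (simp only: mult_ac add_ac)
  qed
  have "(\<Sum>n. bessel_term n k) = A * (\<Sum>n. p n)"
  \<comment> \<open>At a pole of \<open>Gamma\<close> the constant \<open>A\<close> vanishes and
    both sides are 0; otherwise summability of \<open>p\<close> follows by cancelling
    \<open>A\<close>.\<close>
  proof (cases "A = 0")
    case False
    then have "summable p"
      using bessel_term_double_series(1)[of k] by (simp add: * summable_cmult_iff)
    then show ?thesis
      by (simp add: * suminf_mult)
  qed (simp add: *)
  then show ?thesis
    by (simp add: A_def p_def polylog_def add_ac)
qed

text \<open>Writing 2k + d as (d - \<mu>) + (2k + \<mu>) pulls a factor independent of
  \<open>k\<close> out of the row and leaves the series defining \<open>bessel_I\<close>.\<close>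

lemma suminf_bessel_term_bessel_I:
  "(\<Sum>k. bessel_term n k)
     = exp (- a * real (Suc n)) * (b * real (Suc n) / 2) powr (d - \<mu>) * bessel_I \<mu> (b * real (Suc n))"
proof -
  define A where "A = exp (- a * real (Suc n)) * (b * real (Suc n) / 2) powr (d - \<mu>)"
  define q where "q k = (b * real (Suc n) / 2) powr (2 * real k + \<mu>)
    * rGamma (\<mu> + real k + 1) / fact k" for k
  have *: "bessel_term n = (\<lambda>k. A * q k)"
  proof
    fix k
    have "(b * real (Suc n) / 2) powr (2 * real k + d)
        = (b * real (Suc n) / 2) powr (d - \<mu>) * (b * real (Suc n) / 2) powr (2 * real k + \<mu>)"
      unfolding powr_add[symmetric] by (simp add: add_ac)
    then show "bessel_term n k = A * q k"
      by (simp add: bessel_term_def A_def q_def)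
  qed
  have "A \<noteq> 0"
    using ab by (simp add: A_def)
  then have "summable q"
    using bessel_term_double_series(3)[of n] by (simp add: * summable_cmult_iff)
  then have "(\<Sum>k. bessel_term n k) = A * (\<Sum>k. q k)"
    using suminf_mult[of q A] by (simp add: *)
  then show ?thesis
    by (simp only: A_def q_def bessel_I_def)
qed

end

section \<open>Combination of the orders -\<nu> and \<nu>\<close>

theorem mainTheorem5:
  fixes a b \<nu> :: real
  assumes "a > b" and "b > 0" and "\<nu> \<ge> 0"
    and "\<And>m::nat. \<nu> \<noteq> real m / 2"
  shows "summable (\<lambda>k::nat. (b / 2) powr (2 * real k - 2 * \<nu>) / (fact k * Gamma (1 - \<nu> + real k))
             * polylog (- 2 * real k + 2 * \<nu>) (exp (- a)))
       \<and> summable (\<lambda>k::nat. (b / 2) ^ (2 * k) / (fact k * Gamma (1 + \<nu> + real k))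
             * polylog (- 2 * real k) (exp (- a)))
       \<and> (\<lambda>n::nat. exp (- a * real (Suc n)) / (b * real (Suc n) / 2) powr \<nu>
             * bessel_K \<nu> (b * real (Suc n)))
         sums
         (pi / (2 * sin (pi * \<nu>)) *
           ((\<Sum>k::nat. (b / 2) powr (2 * real k - 2 * \<nu>) / (fact k * Gamma (1 - \<nu> + real k))
               * polylog (- 2 * real k + 2 * \<nu>) (exp (- a)))
          - (\<Sum>k::nat. (b / 2) ^ (2 * k) / (fact k * Gamma (1 + \<nu> + real k))
               * polylog (- 2 * real k) (exp (- a)))))"
proof -
  have b0: "- 2 * \<nu> \<le> 0"
    using assms by simp
  define f g where "f = bessel_term a b (- 2 * \<nu>) (- \<nu>)" and "g = bessel_term a b 0 \<nu>"
  note f_series = bessel_term_double_series[OF assms(1,2) b0, of "- \<nu>", folded f_def]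
  note g_series = bessel_term_double_series[OF assms(1,2) order_refl, of \<nu>, folded g_def]
  have f_sum: "(\<Sum>n. f n k) = (b / 2) powr (2 * real k - 2 * \<nu>)
      / (fact k * Gamma (1 - \<nu> + real k)) * polylog (- 2 * real k + 2 * \<nu>) (exp (- a))" for k
    using suminf_bessel_term_polylog[OF assms(1,2) b0, of "- \<nu>" k] by (simp add: f_def)
  have g_sum: "(\<Sum>n. g n k) = (b / 2) ^ (2 * k)
      / (fact k * Gamma (1 + \<nu> + real k)) * polylog (- 2 * real k) (exp (- a))" for k
    using suminf_bessel_term_polylog[OF assms(1,2) order_refl, of \<nu> k] assms(2)
      powr_realpow[of "b / 2" "2 * k"] by (simp add: g_def)
  \<comment> \<open>This selects the quotient branch of \<open>bessel_K\<close>; an integer m is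
    excluded as the half-integer 2m/2.\<close>
  have "\<nu> \<notin> \<int>"
  proof
    assume "\<nu> \<in> \<int>"
    then obtain m where "\<nu> = real m"
      using assms(3) by (metis Ints_cases nat_0_le of_int_0_le_iff of_int_of_nat_eq)
    then show False
      using assms(4)[of "2 * m"] by simp
  qed
  \<comment> \<open>Both rows carry the same prefactor \<open>E / (X / 2) powr \<nu>\<close>, so
    their difference contains exactly the difference that defines \<open>bessel_K\<close>.\<close>
  have term_eq: "pi / (2 * sin (pi * \<nu>)) * ((\<Sum>k. f n k) - (\<Sum>k. g n k))
      = exp (- a * real (Suc n)) / (b * real (Suc n) / 2) powr \<nu> * bessel_K \<nu> (b * real (Suc n))"
    for n
  proof -
    define E X where "E = exp (- a * real (Suc n))" and "X = b * real (Suc n)"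
    have "(\<Sum>k. f n k) = E / (X / 2) powr \<nu> * bessel_I (- \<nu>) X"
      using suminf_bessel_term_bessel_I[OF assms(1,2) b0, of "- \<nu>" n]
      by (simp add: f_def E_def X_def powr_minus_divide)
    moreover have "(\<Sum>k. g n k) = E / (X / 2) powr \<nu> * bessel_I \<nu> X"
      using suminf_bessel_term_bessel_I[OF assms(1,2) order_refl, of \<nu> n]
      by (simp add: g_def E_def X_def powr_minus_divide)
    moreover have "bessel_K \<nu> X = pi / (2 * sin (pi * \<nu>)) * (bessel_I (- \<nu>) X - bessel_I \<nu> X)"
      using \<open>\<nu> \<notin> \<int>\<close> by (simp add: bessel_K_def mult.commute)
    ultimately show ?thesis
      unfolding E_def[symmetric] X_def[symmetric]
      by (simp only: right_diff_distrib) (simp only: mult_ac)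
  qed
  \<comment> \<open>The interchange is applied to each family separately; the column sums then turn
    into the polylogarithm terms.\<close>
  have "(\<lambda>n. pi / (2 * sin (pi * \<nu>)) * ((\<Sum>k. f n k) - (\<Sum>k. g n k)))
      sums (pi / (2 * sin (pi * \<nu>)) * ((\<Sum>k. \<Sum>n. f n k) - (\<Sum>k. \<Sum>n. g n k)))"
    by (intro sums_mult sums_diff f_series(4) g_series(4))
  then show ?thesis
    using f_series(2) g_series(2) unfolding f_sum g_sum term_eq by blast
qed

end
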